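(* Let $T \ge 1$ be an integer, let $d_1,\dots,d_T \ge 1$ be integers, and let $\epsilon \in (0,1)$. Let $(f_1^\star,\dots,f_T^\star)$ be the sequence of odd polynomials generated by the sequential minimax procedure (described in the context) with input $T$, $\{d_t\}_{t=1}^T$, $\epsilon$. Then $(f_1^\star,\dots,f_T^\star)$ is minimax optimal for the composite approximation problem for the sign function, i.e. $f_t^\star\in\mathbb{R}^{\mathrm{odd}}_{d_t}[x]$ for all $t$, and for every choice of polynomials $f_t \in \mathbb{R}^{\mathrm{odd}}_{d_t}[x]$, $t=1,\dots,T$, $$\max_{x \in [-1,-\epsilon]\cup[\epsilon,1]} \left| f_T^\star \circ f_{T-1}^\star\circ\cdots\circ f_1^\star(x) - f_{\mathsf{sign}}(x)\right| \;\le\; \max_{x \in [-1,-\epsilon]\cup[\epsilon,1]} \left| f_T \circ f_{T-1}\circ\cdots\circ f_1(x) - f_{\mathsf{sign}}(x)\right| .$$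
   Context: For an integer $d\ge 1$, $\mathbb{R}^{\mathrm{odd}}_{d}[x]$ denotes the real vector space of odd univariate real polynomials of degree at most $d$. The sign function is $f_{\mathsf{sign}}(x)=1$ for $x>0$, $f_{\mathsf{sign}}(x)=-1$ for $x<0$, and $f_{\mathsf{sign}}(0)=0.5$ (the value at $0$ is irrelevant here). Sequential minimax procedure with input $T$, $\{d_t\}_{t=1}^T$, $\epsilon$: set $a_1=\epsilon$, $b_1=1$. For $t=1,\dots,T$: (1) let $f_t^\star$ be the (unique) minimax approximation of $f_{\mathsf{sign}}$ in $\mathbb{R}^{\mathrm{odd}}_{d_t}[x]$ on $[-b_t,-a_t]\cup[a_t,b_t]$, equivalently on $[a_t,b_t]$, i.e. $$f_t^\star = \operatorname*{arg\,min}_{f\in\mathbb{R}^{\mathrm{odd}}_{d_t}[x]}\ \max_{x\in[a_t,b_t]} |f(x)-f_{\mathsf{sign}}(x)|;$$ (2) let $[a_{t+1},b_{t+1}] = f_t^\star([a_t,b_t])$ be the image of the interval $[a_t,b_t]$ under $f_t^\star$. The $a_t$ remain positive throughout, so every step is well defined: for $0<a<b$ the minimax approximation of a continuous function on $[a,b]$ from $\mathbb{R}^{\mathrm{odd}}_{d}[x]$ exists and is unique. (In the procedure this minimizer is computed by the Remez algorithm, which converges to it; $f_t^\star$ denotes the exact minimizer.) *)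

theory Defs
  imports Complex_Main "HOL-Computational_Algebra.Polynomial"
begin

definition odd_polys :: "nat \<Rightarrow> real poly set" where
  "odd_polys d = {p. degree p \<le> d \<and> (\<forall>x. poly p (- x) = - poly p x)}"

(* Differs from sgn only at 0. *)
definition fsign :: "real \<Rightarrow> real" where
  "fsign x = (if x > 0 then 1 else if x < 0 then -1 else 1/2)"

(* Only used for nonempty compact S on which both g and fsign are continuous,
   so the supremum is a maximum. *)
definition max_error :: "(real \<Rightarrow> real) \<Rightarrow> real set \<Rightarrow> real" where
  "max_error g S = (SUP x\<in>S. \<bar>g x - fsign x\<bar>)"

(* For 0 < a < b the minimiser exists and is unique, so the choice made by arg_min
   is immaterial. *)
definition minimax_approx :: "nat \<Rightarrow> real \<Rightarrow> real \<Rightarrow> real poly" where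
  "minimax_approx d a b = arg_min (\<lambda>p. max_error (poly p) {a..b}) (\<lambda>p. p \<in> odd_polys d)"

(* Indices start at 1; the values of d, f at 0 and beyond T, and of a, b at 0 and
   beyond T + 1, are unconstrained. *)
definition sequential_minimax ::
  "nat \<Rightarrow> (nat \<Rightarrow> nat) \<Rightarrow> real \<Rightarrow> (nat \<Rightarrow> real) \<Rightarrow> (nat \<Rightarrow> real) \<Rightarrow> (nat \<Rightarrow> real poly) \<Rightarrow> bool" where
  "sequential_minimax T d \<epsilon> a b f \<longleftrightarrow>
     a 1 = \<epsilon> \<and> b 1 = 1 \<and>
     (\<forall>t\<in>{1..T}. f t = minimax_approx (d t) (a t) (b t) \<and>
                 {a (t + 1)..b (t + 1)} = poly (f t) ` {a t..b t})"

(* f T o ... o f 1 *)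
primrec poly_chain :: "(nat \<Rightarrow> real poly) \<Rightarrow> nat \<Rightarrow> real \<Rightarrow> real" where
  "poly_chain f 0 = id"
| "poly_chain f (Suc t) = poly (f (Suc t)) \<circ> poly_chain f t"

end

theory Submission
  imports Defs "HOL-Analysis.Elementary_Metric_Spaces" "HOL-Analysis.Function_Topology"
begin

text \<open>
  Only the ratio of the endpoints of an interval \<open>[a, b]\<close> matters, because odd polynomials of
  bounded degree are closed under scaling of the argument and of the value. Rescaling a minimiser
  shows that its error \<open>e\<close> is attained on both sides, so it maps \<open>[a, b]\<close> onto \<open>[1 - e, 1 + e]\<close>, and
  \<open>(1 - e) / (1 + e)\<close> is the largest ratio that any odd polynomial without zeros on \<open>[a, b]\<close> can
  reach. Hence the greedy choice maximises the ratio after every step. A competitor with error below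
  \<open>1\<close> never vanishes, and its sign is irrelevant by oddness, so its ratio never overtakes.
\<close>

subsection \<open>Existence of minimax approximations\<close>

text \<open>
  In the induction step, divide \<open>p - p a\<close> by \<open>x - a\<close>; the quotient is bounded on the right half
  of the interval.
\<close>

lemma coeff_bound_of_bounded_on_interval:
  fixes a b K :: real
  assumes "a < b"
  shows "\<exists>B. \<forall>p. degree p \<le> d \<longrightarrow> (\<forall>x\<in>{a..b}. \<bar>poly p x\<bar> \<le> K) \<longrightarrow> (\<forall>i. \<bar>coeff p i\<bar> \<le> B)"
  using assms
proof (induction d arbitrary: a b K)
  case 0
  show ?case
  proof (intro exI[of _ "\<bar>K\<bar>"] allI impI)
    fix p :: "real poly" and i
    assume "degree p \<le> 0" and K: "\<forall>x\<in>{a..b}. \<bar>poly p x\<bar> \<le> K"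
    then obtain c where c: "p = [:c:]"
      by (metis degree_eq_zeroE le_zero_eq)
    have "\<bar>c\<bar> \<le> K"
      using K 0 c by auto
    then show "\<bar>coeff p i\<bar> \<le> \<bar>K\<bar>"
      using c by (cases i) auto
  qed
next
  case (Suc d)
  define m where "m = (a + b) / 2"
  have m: "a < m" "m < b"
    using Suc.prems by (auto simp: m_def)
  \<comment> \<open>On the right half \<open>\<bar>poly p x - poly p a\<bar>\<close> is at most
    \<open>2 * K\<close>, while \<open>x - a\<close> is at least \<open>m - a\<close>.\<close>
  from Suc.IH[OF m(2), of "2 * K / (m - a)"] obtain B where B:
    "\<And>q i. degree q \<le> d \<Longrightarrow> (\<forall>x\<in>{m..b}. \<bar>poly q x\<bar> \<le> 2 * K / (m - a)) \<Longrightarrow> \<bar>coeff q i\<bar> \<le> B"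
    by blast
  show ?case
  \<comment> \<open>The three summands bound the coefficients of the constant
    \<open>poly p a\<close>, of \<open>a * q\<close> and of \<open>x * q\<close>.\<close>
  proof (intro exI[of _ "\<bar>K\<bar> + \<bar>a\<bar> * B + B"] allI impI)
    fix p :: "real poly" and i
    assume deg: "degree p \<le> Suc d" and K: "\<forall>x\<in>{a..b}. \<bar>poly p x\<bar> \<le> K"
    have "poly (p - [:poly p a:]) a = 0"
      by simp
    then obtain q where q: "p - [:poly p a:] = [:- a, 1:] * q"
      unfolding poly_eq_0_iff_dvd by (elim dvdE)
    then have p: "p = [:poly p a:] + [:- a, 1:] * q"
      by (metis add.commute diff_add_cancel)
    have degq: "degree q \<le> d"
    proof (cases "q = 0")
      case False
      have "degree (p - [:poly p a:]) = Suc (degree q)"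
        using False unfolding q by (subst degree_mult_eq) auto
      moreover have "degree (p - [:poly p a:]) \<le> Suc d"
        using deg by (intro degree_diff_le) auto
      ultimately show ?thesis
        by simp
    qed simp
    have "\<bar>poly q x\<bar> \<le> 2 * K / (m - a)" if x: "x \<in> {m..b}" for x
    proof -
      have "poly p x - poly p a = (x - a) * poly q x"
        using arg_cong[OF q, of "\<lambda>r. poly r x"] by (simp add: algebra_simps)
      moreover have "\<bar>poly p x\<bar> \<le> K" "\<bar>poly p a\<bar> \<le> K"
        using K x m by auto
      ultimately have "\<bar>x - a\<bar> * \<bar>poly q x\<bar> \<le> 2 * K"
        by (simp flip: abs_mult)
      moreover have "(m - a) * \<bar>poly q x\<bar> \<le> \<bar>x - a\<bar> * \<bar>poly q x\<bar>"
        using x m by (intro mult_right_mono) auto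
      ultimately show ?thesis
        using m by (simp add: field_simps)
    qed
    then have Bq: "\<bar>coeff q j\<bar> \<le> B" for j
      using B degq by blast
    have pa: "\<bar>poly p a\<bar> \<le> K"
      using K m by auto
    have aB: "\<bar>a * coeff q j\<bar> \<le> \<bar>a\<bar> * B" for j
      using Bq by (simp add: abs_mult mult_left_mono)
    have "coeff p i = coeff [:poly p a:] i - a * coeff q i + coeff (pCons 0 q) i"
      using arg_cong[OF p, of "\<lambda>r. coeff r i"] by simp
    moreover have "\<bar>coeff [:poly p a:] i\<bar> \<le> \<bar>K\<bar>"
      using pa by (cases i) auto
    moreover have "\<bar>coeff (pCons 0 q) i\<bar> \<le> B"
      using Bq order_trans[OF abs_ge_zero Bq] by (cases i) auto
    ultimately show "\<bar>coeff p i\<bar> \<le> \<bar>K\<bar> + \<bar>a\<bar> * B + B"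
      using aB[of i] by linarith
  qed
qed

text \<open>The coefficient sequences lie in a product of copies of \<open>{- B..B}\<close>, which
  is compact by Tychonoff. A limit in the product topology is a limit of each coefficient, and
  evaluation at a point involves only the first \<open>d + 1\<close> of them.\<close>

lemma bounded_polys_convergent_subseq:
  fixes P :: "nat \<Rightarrow> real poly"
  assumes deg: "\<And>n. degree (P n) \<le> d" and B: "\<And>n i. \<bar>coeff (P n) i\<bar> \<le> B"
  obtains p r where "degree p \<le> d" "strict_mono r"
    "\<And>x. (\<lambda>n. poly (P (r n)) x) \<longlonglongrightarrow> poly p x"
proof -
  have "compact (PiE UNIV (\<lambda>i::nat. {- B..B}))"
    unfolding compactin_euclidean_iff[symmetric] euclidean_product_topology[symmetric]
    by (simp add: compactin_PiE)
  then have "seq_compact (PiE UNIV (\<lambda>i::nat. {- B..B}))"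
    by (rule compact_imp_seq_compact)
  moreover have "\<forall>n. coeff (P n) \<in> PiE UNIV (\<lambda>i::nat. {- B..B})"
    using B by (auto simp: abs_le_iff minus_le_iff)
  ultimately obtain c r where r: "strict_mono r" and lim: "((\<lambda>n. coeff (P n)) \<circ> r) \<longlonglongrightarrow> c"
    by (metis seq_compactE)
  have coeff_lim: "(\<lambda>n. coeff (P (r n)) i) \<longlonglongrightarrow> c i" for i
    using continuous_on_tendsto_compose[OF continuous_on_product_coordinates lim, of i]
    by (simp add: o_def)
  define p where "p = (\<Sum>i\<le>d. monom (c i) i)"
  show ?thesis
  proof
    show "degree p \<le> d"
      unfolding p_def by (intro degree_sum_le) (auto intro: order_trans[OF degree_monom_le])
    show "strict_mono r" by fact
    fix x
    have "poly (P n) x = (\<Sum>i\<le>d. coeff (P n) i * x ^ i)" for n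
      using arg_cong[OF poly_as_sum_of_monoms'[OF deg], of "\<lambda>q. poly q x"]
      by (simp add: poly_sum poly_monom)
    moreover have "poly p x = (\<Sum>i\<le>d. c i * x ^ i)"
      by (simp add: p_def poly_sum poly_monom)
    ultimately show "(\<lambda>n. poly (P (r n)) x) \<longlonglongrightarrow> poly p x"
      by (auto intro!: tendsto_sum tendsto_mult_right coeff_lim)
  qed
qed

section \<open>The maximal error on a positive interval, where \<open>fsign\<close> is constantly
  1\<close>

lemma max_error_upper:
  assumes "0 < a" "continuous_on {a..b} g" "x \<in> {a..b}"
  shows "\<bar>g x - 1\<bar> \<le> max_error g {a..b}"
proof -
  have "(SUP x\<in>{a..b}. \<bar>g x - fsign x\<bar>) = (SUP x\<in>{a..b}. \<bar>g x - 1\<bar>)"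
    using assms(1) by (intro SUP_cong) (auto simp: fsign_def)
  moreover have "compact ((\<lambda>x. \<bar>g x - 1\<bar>) ` {a..b})"
    by (intro compact_continuous_image continuous_intros assms(2) compact_Icc)
  ultimately show ?thesis
    using assms(3) unfolding max_error_def
    by (auto intro!: cSUP_upper bounded_imp_bdd_above compact_imp_bounded)
qed

lemma max_error_least:
  assumes "0 < a" "a \<le> b" "\<And>x. x \<in> {a..b} \<Longrightarrow> \<bar>g x - 1\<bar> \<le> e"
  shows "max_error g {a..b} \<le> e"
  using assms unfolding max_error_def by (intro cSUP_least) (auto simp: fsign_def)

lemma max_error_poly_nonneg:
  assumes "0 < a" "a \<le> b"
  shows "0 \<le> max_error (poly p) {a..b}"
proof -
  have "\<bar>poly p a - 1\<bar> \<le> max_error (poly p) {a..b}"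
    using assms by (intro max_error_upper continuous_intros) auto
  then show ?thesis by linarith
qed

section \<open>Closure properties of odd polynomials and existence of a minimiser\<close>

lemma smult_odd_polys: "p \<in> odd_polys d \<Longrightarrow> smult c p \<in> odd_polys d"
  by (auto simp: odd_polys_def intro: order_trans[OF degree_smult_le])

lemma pcompose_linear_odd_polys: "p \<in> odd_polys d \<Longrightarrow> pcompose p [:0, c:] \<in> odd_polys d"
  by (auto simp: odd_polys_def poly_pcompose intro: order_trans[OF degree_pcompose_le])

lemma linear_odd_polys: "1 \<le> d \<Longrightarrow> [:0, c:] \<in> odd_polys d"
  by (auto simp: odd_polys_def)

text \<open>A minimising sequence is uniformly bounded on the interval, hence has bounded
  coefficients and a pointwise convergent subsequence. Oddness and the pointwise error bounds pass
  to the limit.\<close>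

lemma odd_polys_minimiser_exists:
  assumes "0 < a" "a \<le> b" "1 \<le> d"
  shows "\<exists>p\<in>odd_polys d. \<forall>q\<in>odd_polys d. max_error (poly p) {a..b} \<le> max_error (poly q) {a..b}"
proof (cases "a = b")
  case True
  \<comment> \<open>On a one-point interval the line through the origin and \<open>(a, 1)\<close> is
    exact. The compactness argument of the other case relies on \<open>a < b\<close>.\<close>
  have "max_error (poly [:0, 1 / a:]) {a..b} \<le> 0"
    using assms True by (intro max_error_least) auto
  then show ?thesis
    using linear_odd_polys[OF assms(3), of "1 / a"] max_error_poly_nonneg[OF assms(1,2)]
    by (meson order_trans)
next
  case False
  define E where "E = (\<lambda>p. max_error (poly p) {a..b})"
  define I where "I = (INF p\<in>odd_polys d. E p)"
  have bdd: "bdd_below (E ` odd_polys d)"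
    unfolding E_def using max_error_poly_nonneg[OF assms(1,2)] by (auto intro!: bdd_belowI[of _ 0])
  have ne: "odd_polys d \<noteq> {}"
    using linear_odd_polys[OF assms(3)] by blast
  have "\<exists>p\<in>odd_polys d. E p < I + 1 / real (Suc n)" for n
    using cInf_lessD[of "E ` odd_polys d" "I + 1 / real (Suc n)"] ne by (auto simp: I_def)
  then obtain P where P: "\<And>n. P n \<in> odd_polys d" "\<And>n. E (P n) < I + 1 / real (Suc n)"
    by metis
  have dev: "\<bar>poly (P n) x - 1\<bar> \<le> I + 1 / real (Suc n)" if "x \<in> {a..b}" for n x
  proof -
    have "\<bar>poly (P n) x - 1\<bar> \<le> E (P n)"
      using assms(1) that unfolding E_def by (intro max_error_upper continuous_intros)
    with P(2)[of n] show ?thesis by linarith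
  qed
  \<comment> \<open>The deviation from 1 is at most \<open>I + 1\<close>, which leaves one more unit
    for the target value itself.\<close>
  have "\<bar>poly (P n) x\<bar> \<le> I + 2" if "x \<in> {a..b}" for n x
  proof -
    have "1 / real (Suc n) \<le> 1" by simp
    then show ?thesis using dev[OF that, of n] by linarith
  qed
  moreover have deg: "degree (P n) \<le> d" for n
    using P(1) by (auto simp: odd_polys_def)
  moreover obtain B where "\<forall>p. degree p \<le> d \<longrightarrow> (\<forall>x\<in>{a..b}. \<bar>poly p x\<bar> \<le> I + 2) \<longrightarrow> (\<forall>i. \<bar>coeff p i\<bar> \<le> B)"
    using coeff_bound_of_bounded_on_interval[of a b d "I + 2"] False assms(2) by force
  ultimately have "\<And>n i. \<bar>coeff (P n) i\<bar> \<le> B"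
    by blast
  then obtain p r where p: "degree p \<le> d" "strict_mono r"
    and lim: "\<And>x. (\<lambda>n. poly (P (r n)) x) \<longlonglongrightarrow> poly p x"
    using bounded_polys_convergent_subseq[of P d B] deg by blast
  have "poly p (- x) = - poly p x" for x
  proof (rule LIMSEQ_unique)
    show "(\<lambda>n. poly (P (r n)) (- x)) \<longlonglongrightarrow> poly p (- x)" by (rule lim)
    show "(\<lambda>n. poly (P (r n)) (- x)) \<longlonglongrightarrow> - poly p x"
      using tendsto_minus[OF lim[of x]] P(1) by (simp add: odd_polys_def)
  qed
  with p(1) have odd: "p \<in> odd_polys d"
    by (simp add: odd_polys_def)
  have "\<bar>poly p x - 1\<bar> \<le> I" if x: "x \<in> {a..b}" for x
  proof (rule LIMSEQ_le)
    show "(\<lambda>n. \<bar>poly (P (r n)) x - 1\<bar>) \<longlonglongrightarrow> \<bar>poly p x - 1\<bar>"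
      by (intro tendsto_intros lim)
    have "(\<lambda>n. I + 1 / real (Suc n)) \<longlonglongrightarrow> I + 0"
      by (intro tendsto_intros LIMSEQ_Suc[OF lim_1_over_n])
    from LIMSEQ_subseq_LIMSEQ[OF this p(2)]
    show "(\<lambda>n. I + 1 / real (Suc (r n))) \<longlonglongrightarrow> I"
      by (simp add: o_def)
    show "\<exists>N. \<forall>n\<ge>N. \<bar>poly (P (r n)) x - 1\<bar> \<le> I + 1 / real (Suc (r n))"
      using dev[OF x] by blast
  qed
  then have "E p \<le> I"
    unfolding E_def by (intro max_error_least assms)
  moreover have "I \<le> E q" if "q \<in> odd_polys d" for q
    unfolding I_def by (intro cINF_lower bdd that)
  ultimately show ?thesis
    using odd by (force simp: E_def)
qed

text \<open>\<open>arg_min\<close> is a Hilbert choice, so existence of a minimiser gives the chosen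
  polynomial both properties.\<close>

lemma
  assumes "0 < a" "a \<le> b" "1 \<le> d"
  shows minimax_approx_odd: "minimax_approx d a b \<in> odd_polys d"
    and minimax_approx_le:
      "q \<in> odd_polys d \<Longrightarrow> max_error (poly (minimax_approx d a b)) {a..b} \<le> max_error (poly q) {a..b}"
proof -
  have "is_arg_min (\<lambda>p. max_error (poly p) {a..b}) (\<lambda>p. p \<in> odd_polys d) (minimax_approx d a b)"
    unfolding minimax_approx_def arg_min_def
    by (rule someI_ex) (use odd_polys_minimiser_exists[OF assms] in \<open>auto simp: is_arg_min_linorder\<close>)
  then show "minimax_approx d a b \<in> odd_polys d"
    and "q \<in> odd_polys d \<Longrightarrow> max_error (poly (minimax_approx d a b)) {a..b} \<le> max_error (poly q) {a..b}"
    by (auto simp: is_arg_min_linorder)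
qed

subsection \<open>One greedy step\<close>

lemma nonvanishing_continuous_sgn:
  fixes g :: "real \<Rightarrow> real"
  assumes "continuous_on {a..b} g" "\<And>x. x \<in> {a..b} \<Longrightarrow> g x \<noteq> 0"
  obtains s where "\<bar>s\<bar> = 1" "\<And>x. x \<in> {a..b} \<Longrightarrow> s * g x = \<bar>g x\<bar>"
proof (cases "\<exists>x\<in>{a..b}. g x < 0")
  case True
  then obtain x where x: "x \<in> {a..b}" "g x < 0" by blast
  have conn: "connected (g ` {a..b})"
    by (intro connected_continuous_image assms connected_Icc)
  have "g y < 0" if "y \<in> {a..b}" for y
  proof (rule ccontr)
    assume "\<not> g y < 0"
    then have "0 \<in> g ` {a..b}"
      using connectedD_interval[OF conn, of "g x" "g y" 0] x that by auto
    then show False using assms(2) by force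
  qed
  then show ?thesis
    by (intro that[of "-1"]) (auto simp: abs_if dest: less_asym)
next
  case False
  then show ?thesis
    by (intro that[of 1]) (auto simp: abs_if)
qed

text \<open>Let \<open>m\<close> and \<open>M\<close> be the extreme values of
  \<open>\<bar>poly g x\<bar>\<close>. Some multiple of \<open>g\<close> has error at most
  \<open>(M - m) / (m + M)\<close>, so \<open>e\<close> is at most this quotient, which rearranges
  to \<open>m / M \<le> (1 - e) / (1 + e)\<close>. The conclusion states this ratio bound without
  division.\<close>

lemma minimax_ratio_optimal:
  assumes "0 < a" "a \<le> b" "1 \<le> d" "g \<in> odd_polys d" "\<And>x. x \<in> {a..b} \<Longrightarrow> poly g x \<noteq> 0"
  defines "e \<equiv> max_error (poly (minimax_approx d a b)) {a..b}"
  obtains z w where "z \<in> {a..b}" "w \<in> {a..b}"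
    "\<bar>poly g z\<bar> * (1 + e) \<le> (1 - e) * \<bar>poly g w\<bar>"
proof -
  obtain s where s: "\<bar>s\<bar> = 1" "\<And>x. x \<in> {a..b} \<Longrightarrow> s * poly g x = \<bar>poly g x\<bar>"
    by (rule nonvanishing_continuous_sgn[of a b "poly g"]) (use assms(5) in \<open>auto intro!: continuous_intros\<close>)
  have cont: "continuous_on {a..b} (\<lambda>x. \<bar>poly g x\<bar>)"
    by (intro continuous_intros)
  obtain z where z: "z \<in> {a..b}" "\<And>x. x \<in> {a..b} \<Longrightarrow> \<bar>poly g z\<bar> \<le> \<bar>poly g x\<bar>"
    using continuous_attains_inf[OF compact_Icc _ cont] assms(2) by auto
  obtain w where w: "w \<in> {a..b}" "\<And>x. x \<in> {a..b} \<Longrightarrow> \<bar>poly g x\<bar> \<le> \<bar>poly g w\<bar>"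
    using continuous_attains_sup[OF compact_Icc _ cont] assms(2) by auto
  define m M where "m = \<bar>poly g z\<bar>" and "M = \<bar>poly g w\<bar>"
  have m: "0 < m" "m \<le> M"
    using assms(5) z w by (auto simp: m_def M_def)
  \<comment> \<open>The sign \<open>s\<close> makes \<open>g\<close> positive on the interval, and
    the factor \<open>2 / (m + M)\<close> moves the midpoint of \<open>{m..M}\<close> to 1.\<close>
  have "max_error (poly (smult (2 * s / (m + M)) g)) {a..b} \<le> (M - m) / (m + M)"
  proof (intro max_error_least assms)
    fix x assume x: "x \<in> {a..b}"
    have "poly (smult (2 * s / (m + M)) g) x - 1 = (2 * \<bar>poly g x\<bar> - (m + M)) / (m + M)"
      using m s(2)[OF x] by (simp add: field_simps)
    moreover have "\<bar>2 * \<bar>poly g x\<bar> - (m + M)\<bar> \<le> M - m"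
      using z(2)[OF x] w(2)[OF x] unfolding m_def M_def by linarith
    ultimately show "\<bar>poly (smult (2 * s / (m + M)) g) x - 1\<bar> \<le> (M - m) / (m + M)"
      using m by (simp add: abs_divide divide_right_mono)
  qed
  then have "e \<le> (M - m) / (m + M)"
    using minimax_approx_le[OF assms(1-3) smult_odd_polys[OF assms(4)]] unfolding e_def
    by (rule order_trans[rotated])
  then have "m * (1 + e) \<le> (1 - e) * M"
    using m by (simp add: field_simps)
  with z(1) w(1) show ?thesis
    using that by (simp add: m_def M_def)
qed

text \<open>The competitor \<open>x / b\<close> takes values between \<open>a / b\<close> and 1, so
  its error is at most \<open>1 - a / b\<close>.\<close>

lemma minimax_error_less_1:
  assumes "0 < a" "a \<le> b" "1 \<le> d"
  shows "max_error (poly (minimax_approx d a b)) {a..b} < 1"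
proof -
  have "max_error (poly (minimax_approx d a b)) {a..b} \<le> max_error (poly [:0, 1 / b:]) {a..b}"
    by (intro minimax_approx_le linear_odd_polys assms)
  also have "\<dots> \<le> 1 - a / b"
    using assms by (intro max_error_least) (auto simp: field_simps)
  also have "\<dots> < 1"
    using assms by simp
  finally show ?thesis .
qed

text \<open>The ratio bound applied to the minimiser itself yields two values of ratio at most
  \<open>(1 - e) / (1 + e)\<close>. Inside \<open>{1 - e..1 + e}\<close> only the two endpoints
  achieve this, and the intermediate value theorem fills the gap.\<close>

lemma minimax_image:
  assumes "0 < a" "a \<le> b" "1 \<le> d"
  defines "p \<equiv> minimax_approx d a b"
  defines "e \<equiv> max_error (poly p) {a..b}"
  shows "poly p ` {a..b} = {1 - e..1 + e}"
proof -
  have e: "0 \<le> e" "e < 1"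
    using minimax_error_less_1[OF assms(1-3)] max_error_poly_nonneg[OF assms(1,2)]
    by (auto simp: e_def p_def)
  have dev: "\<bar>poly p x - 1\<bar> \<le> e" if "x \<in> {a..b}" for x
    using that assms(1) unfolding e_def by (intro max_error_upper continuous_intros) auto
  have bounds: "1 - e \<le> poly p x" "poly p x \<le> 1 + e" if "x \<in> {a..b}" for x
    using dev[OF that] by auto
  have "poly p x \<noteq> 0" if "x \<in> {a..b}" for x
    using bounds(1)[OF that] e by auto
  then obtain z w where zw: "z \<in> {a..b}" "w \<in> {a..b}"
    and "\<bar>poly p z\<bar> * (1 + e) \<le> (1 - e) * \<bar>poly p w\<bar>"
    using minimax_ratio_optimal[OF assms(1-3) minimax_approx_odd[OF assms(1-3)]]
    unfolding p_def e_def by metis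
  then have le: "poly p z * (1 + e) \<le> (1 - e) * poly p w"
    using bounds[of z] bounds[of w] e by simp
  \<comment> \<open>Together with \<open>le\<close> these form a chain that starts and ends at
    \<open>(1 - e) * (1 + e)\<close>, so every inequality in it is an equality.\<close>
  have "(1 - e) * poly p w \<le> (1 - e) * (1 + e)" "(1 - e) * (1 + e) \<le> poly p z * (1 + e)"
    using bounds[OF zw(1)] bounds[OF zw(2)] e by (auto intro: mult_left_mono mult_right_mono)
  with le have "poly p z * (1 + e) = (1 - e) * (1 + e)" "(1 - e) * poly p w = (1 - e) * (1 + e)"
    by linarith+
  then have "poly p z = 1 - e" "poly p w = 1 + e"
    using e by auto
  moreover have "connected (poly p ` {a..b})"
    by (intro connected_continuous_image continuous_intros connected_Icc)
  ultimately have "{1 - e..1 + e} \<subseteq> poly p ` {a..b}"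
    using zw by (metis connected_contains_Icc image_eqI)
  then show ?thesis
    using bounds by auto
qed

subsection \<open>Compositions\<close>

lemma continuous_on_poly_chain: "continuous_on S (poly_chain f t)"
proof (induction t)
  case (Suc t)
  then show ?case
    by (simp add: o_def continuous_on_poly)
qed (simp add: id_def)

lemma poly_chain_minus:
  assumes "\<forall>t\<in>{1..T}. f t \<in> odd_polys (d t)"
  shows "poly_chain f T (- x) = - poly_chain f T x"
  using assms by (induction T) (auto simp: odd_polys_def)

lemma odd_polys_poly_0: "p \<in> odd_polys d \<Longrightarrow> poly p 0 = 0"
  unfolding odd_polys_def by (metis (mono_tags, lifting) add.inverse_neutral mem_Collect_eq neg_equal_zero)

text \<open>Odd polynomials fix 0, so a chain that reaches 0 stays there.\<close>

lemma poly_chain_nonzero_downward: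
  assumes "\<forall>t\<in>{1..T}. f t \<in> odd_polys (d t)" "poly_chain f T x \<noteq> 0" "t \<le> T"
  shows "poly_chain f t x \<noteq> 0"
  using assms
proof (induction T)
  case (Suc T)
  have "poly_chain f T x \<noteq> 0"
    using Suc.prems odd_polys_poly_0[of "f (Suc T)"] by fastforce
  then show ?case
    using Suc by (cases "t = Suc T") auto
qed simp

text \<open>Away from 0 \<open>fsign\<close> is odd like \<open>g\<close>, so reflection preserves
  the set of error values. This reduces the two-sided domain to its positive half.\<close>

lemma max_error_symmetric:
  assumes "0 < a" "a \<le> b" "continuous_on {a..b} g" "\<And>x. g (- x) = - g x"
  shows "max_error g ({- b..- a} \<union> {a..b}) = max_error g {a..b}"
proof -
  have "{- b..- a} = uminus ` {a..b}"
    by simp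
  moreover have "\<bar>g (- x) - fsign (- x)\<bar> = \<bar>g x - fsign x\<bar>" if "x \<in> {a..b}" for x
    using that assms(1,4) by (simp add: fsign_def abs_minus_commute)
  ultimately have "(\<lambda>x. \<bar>g x - fsign x\<bar>) ` {- b..- a} = (\<lambda>x. \<bar>g x - fsign x\<bar>) ` {a..b}"
    by (simp only: image_image cong: image_cong)
  then show ?thesis
    unfolding max_error_def by (simp only: image_Un Un_absorb)
qed

text \<open>Positivity of the interval propagates: each image is \<open>{1 - e..1 + e}\<close> with
  \<open>e < 1\<close>.\<close>

lemma sequential_minimax_intervals:
  assumes "\<forall>t\<in>{1..T}. d t \<ge> 1" "0 < \<epsilon>" "\<epsilon> < 1" "sequential_minimax T d \<epsilon> a b f" "t \<in> {1..T}"
  defines "e \<equiv> max_error (poly (f t)) {a t..b t}"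
  shows "0 < a t \<and> a t \<le> b t \<and> a (Suc t) = 1 - e \<and> b (Suc t) = 1 + e \<and> 0 \<le> e \<and> e < 1"
proof -
  have f: "f t = minimax_approx (d t) (a t) (b t)" "{a (Suc t)..b (Suc t)} = poly (f t) ` {a t..b t}"
    if "t \<in> {1..T}" for t
    using assms(4) that by (auto simp: sequential_minimax_def)
  have step: "a (Suc t) = 1 - e \<and> b (Suc t) = 1 + e \<and> 0 \<le> e \<and> e < 1"
    if "t \<in> {1..T}" "0 < a t" "a t \<le> b t" "e = max_error (poly (f t)) {a t..b t}" for t e
  proof -
    have dt: "1 \<le> d t" using assms(1) that by blast
    have e: "0 \<le> e" "e < 1"
      using max_error_poly_nonneg[OF that(2,3)] minimax_error_less_1[OF that(2,3) dt] f(1)[OF that(1)] that(4)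
      by auto
    have "{a (Suc t)..b (Suc t)} = {1 - e..1 + e}"
      using minimax_image[OF that(2,3) dt] f[OF that(1)] that(4) by simp
    \<comment> \<open>Equal intervals determine their endpoints because
      \<open>{1 - e..1 + e}\<close> is nonempty.\<close>
    then show ?thesis
      using e by (auto simp: Icc_eq_Icc)
  qed
  have "0 < a t \<and> a t \<le> b t"
    using assms(5)
  proof (induction t)
    case (Suc t)
    show ?case
    \<comment> \<open>Index 0 lies outside \<open>{1..T}\<close>, so the true base case is
      \<open>Suc 0\<close>, with endpoints \<open>\<epsilon>\<close> and 1.\<close>
    proof (cases "t = 0")
      case True
      then show ?thesis using assms(2-4) by (simp add: sequential_minimax_def)
    next
      case False
      then show ?thesis using step[of t] Suc by fastforce
    qed
  qed simp
  then show ?thesis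
    using step[OF assms(5)] e_def by blast
qed

lemma poly_chain_sequential_minimax_mem:
  assumes "sequential_minimax T d \<epsilon> a b f" "x \<in> {\<epsilon>..1}" "t \<le> T"
  shows "poly_chain f t x \<in> {a (Suc t)..b (Suc t)}"
  using assms(3)
proof (induction t)
  case 0
  then show ?case using assms(1,2) by (simp add: sequential_minimax_def)
next
  case (Suc t)
  then have "{a (Suc (Suc t))..b (Suc (Suc t))} = poly (f (Suc t)) ` {a (Suc t)..b (Suc t)}"
    using assms(1) by (simp add: sequential_minimax_def)
  then show ?case using Suc by simp
qed

text \<open>This is the invariant of the greedy argument: the ratio of smallest to largest absolute
  value of the competing chain is at most \<open>a (Suc t) / b (Suc t)\<close>. Its range of
  absolute values then contains a scaled copy of the greedy interval. Absorbing the scale into the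
  next competing factor allows \<open>minimax_ratio_optimal\<close> to be applied on the greedy
  interval.\<close>

lemma poly_chain_ratio_le:
  assumes "\<forall>t\<in>{1..T}. d t \<ge> 1" "0 < \<epsilon>" "\<epsilon> < 1" "sequential_minimax T d \<epsilon> a b fstar"
    and f: "\<forall>t\<in>{1..T}. f t \<in> odd_polys (d t)"
    and nz: "\<And>x. x \<in> {\<epsilon>..1} \<Longrightarrow> poly_chain f T x \<noteq> 0"
    and "t \<le> T"
  shows "\<exists>x\<in>{\<epsilon>..1}. \<exists>y\<in>{\<epsilon>..1}.
    \<bar>poly_chain f t x\<bar> * b (Suc t) \<le> a (Suc t) * \<bar>poly_chain f t y\<bar>"
  using assms(7)
proof (induction t)
  case 0
  have "\<epsilon> \<in> {\<epsilon>..1}" "1 \<in> {\<epsilon>..1}" "\<bar>poly_chain f 0 \<epsilon>\<bar> * b (Suc 0) \<le> a (Suc 0) * \<bar>poly_chain f 0 1\<bar>"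
    using assms(2-4) by (auto simp: sequential_minimax_def)
  then show ?case by blast
next
  case (Suc t)
  define A B D where "A = a (Suc t)" and "B = b (Suc t)" and "D = d (Suc t)"
  define e where "e = max_error (poly (minimax_approx D A B)) {A..B}"
  have mem: "Suc t \<in> {1..T}"
    using Suc.prems by auto
  have fstar: "fstar (Suc t) = minimax_approx D A B"
    using assms(4) mem by (simp add: sequential_minimax_def A_def B_def D_def)
  have AB: "0 < A" "A \<le> B" and next_ab: "a (Suc (Suc t)) = 1 - e" "b (Suc (Suc t)) = 1 + e"
    using sequential_minimax_intervals[OF assms(1-4) mem] fstar by (auto simp: A_def B_def e_def)
  have D: "1 \<le> D" and odd: "f (Suc t) \<in> odd_polys D"
    using assms(1) f mem by (auto simp: D_def)
  obtain x y where xy: "x \<in> {\<epsilon>..1}" "y \<in> {\<epsilon>..1}"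
    and ratio: "\<bar>poly_chain f t x\<bar> * B \<le> A * \<bar>poly_chain f t y\<bar>"
    using Suc by (auto simp: A_def B_def)
  \<comment> \<open>This scale sends \<open>B\<close> to
    \<open>\<bar>poly_chain f t y\<bar>\<close>; by \<open>ratio\<close> it sends \<open>A\<close>
    to a value no smaller than \<open>\<bar>poly_chain f t x\<bar>\<close>.\<close>
  define c where "c = \<bar>poly_chain f t y\<bar> / B"
  have "connected ((\<lambda>u. \<bar>poly_chain f t u\<bar>) ` {\<epsilon>..1})"
    by (intro connected_continuous_image continuous_intros continuous_on_poly_chain connected_Icc)
  then have sub: "{\<bar>poly_chain f t x\<bar>..\<bar>poly_chain f t y\<bar>} \<subseteq> (\<lambda>u. \<bar>poly_chain f t u\<bar>) ` {\<epsilon>..1}"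
    using xy by (intro connected_contains_Icc) auto
  have lift: "\<exists>u\<in>{\<epsilon>..1}. \<bar>poly (f (Suc t)) (c * z)\<bar> = \<bar>poly_chain f (Suc t) u\<bar>" if "z \<in> {A..B}" for z
  proof -
    have "\<bar>poly_chain f t x\<bar> \<le> c * A"
      using ratio AB by (simp add: c_def field_simps)
    moreover have "0 \<le> c"
      using AB by (simp add: c_def)
    then have "c * A \<le> c * z" "c * z \<le> c * B"
      using that by (auto intro: mult_left_mono)
    moreover have "c * B = \<bar>poly_chain f t y\<bar>"
      using AB by (simp add: c_def)
    ultimately have "c * z \<in> {\<bar>poly_chain f t x\<bar>..\<bar>poly_chain f t y\<bar>}"
      by simp
    with sub obtain u where u: "u \<in> {\<epsilon>..1}" "c * z = \<bar>poly_chain f t u\<bar>"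
      by blast
    \<comment> \<open>Oddness makes the sign of the inner value irrelevant, so it suffices to reach
      \<open>c * z\<close> in absolute value.\<close>
    have "\<bar>poly (f (Suc t)) \<bar>v\<bar>\<bar> = \<bar>poly (f (Suc t)) v\<bar>" for v
      using odd by (auto simp: odd_polys_def abs_if)
    then show ?thesis using u by auto
  qed
  define g where "g = pcompose (f (Suc t)) [:0, c:]"
  have g: "poly g z = poly (f (Suc t)) (c * z)" for z
    by (simp add: g_def poly_pcompose mult.commute)
  have "g \<in> odd_polys D"
    unfolding g_def by (intro pcompose_linear_odd_polys odd)
  \<comment> \<open>By \<open>lift\<close>, a zero of \<open>g\<close> would be a zero of the chain
    at stage \<open>Suc t\<close>, hence of the complete chain.\<close>
  moreover have "poly g z \<noteq> 0" if "z \<in> {A..B}" for z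
    using lift[OF that] poly_chain_nonzero_downward[OF f nz Suc.prems] unfolding g by fastforce
  ultimately obtain z w where zw: "z \<in> {A..B}" "w \<in> {A..B}"
    "\<bar>poly g z\<bar> * (1 + e) \<le> (1 - e) * \<bar>poly g w\<bar>"
    using minimax_ratio_optimal[OF AB D] unfolding e_def by metis
  obtain x' where "x' \<in> {\<epsilon>..1}" "\<bar>poly g z\<bar> = \<bar>poly_chain f (Suc t) x'\<bar>"
    using lift[OF zw(1)] g by auto
  moreover obtain y' where "y' \<in> {\<epsilon>..1}" "\<bar>poly g w\<bar> = \<bar>poly_chain f (Suc t) y'\<bar>"
    using lift[OF zw(2)] g by auto
  ultimately show ?case
    using zw(3) unfolding next_ab by metis
qed

section \<open>Comparison of the final errors\<close>

theorem theorem1: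
  fixes T :: nat and d :: "nat \<Rightarrow> nat" and \<epsilon> :: real
    and a b :: "nat \<Rightarrow> real" and fstar :: "nat \<Rightarrow> real poly"
  assumes "T \<ge> 1"
    and "\<forall>t\<in>{1..T}. d t \<ge> 1"
    and "0 < \<epsilon>" and "\<epsilon> < 1"
    and "sequential_minimax T d \<epsilon> a b fstar"
  shows "(\<forall>t\<in>{1..T}. fstar t \<in> odd_polys (d t)) \<and>
    (\<forall>f :: nat \<Rightarrow> real poly. (\<forall>t\<in>{1..T}. f t \<in> odd_polys (d t)) \<longrightarrow>
       max_error (poly_chain fstar T) ({-1..-\<epsilon>} \<union> {\<epsilon>..1})
         \<le> max_error (poly_chain f T) ({-1..-\<epsilon>} \<union> {\<epsilon>..1}))"
proof (intro conjI allI impI)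
  note intervals = sequential_minimax_intervals[OF assms(2-5)]
  show odd: "\<forall>t\<in>{1..T}. fstar t \<in> odd_polys (d t)"
  proof
    fix t assume t: "t \<in> {1..T}"
    then have "fstar t = minimax_approx (d t) (a t) (b t)"
      using assms(5) by (simp add: sequential_minimax_def)
    then show "fstar t \<in> odd_polys (d t)"
      using minimax_approx_odd intervals[OF t] assms(2) t by simp
  qed
  fix f :: "nat \<Rightarrow> real poly"
  assume f: "\<forall>t\<in>{1..T}. f t \<in> odd_polys (d t)"
  have sym: "max_error (poly_chain h T) ({-1..-\<epsilon>} \<union> {\<epsilon>..1}) = max_error (poly_chain h T) {\<epsilon>..1}"
    if "\<forall>t\<in>{1..T}. h t \<in> odd_polys (d t)" for h
    using assms(3,4) continuous_on_poly_chain poly_chain_minus[OF that]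
    by (intro max_error_symmetric) auto
  define e where "e = max_error (poly (fstar T)) {a T..b T}"
  define r where "r = max_error (poly_chain f T) {\<epsilon>..1}"
  have ab: "a (Suc T) = 1 - e" "b (Suc T) = 1 + e" and e: "0 \<le> e" "e < 1"
    using intervals[of T] assms(1) by (auto simp: e_def)
  have "\<bar>poly_chain fstar T x - 1\<bar> \<le> e" if "x \<in> {\<epsilon>..1}" for x
    using poly_chain_sequential_minimax_mem[OF assms(5) that, of T] ab by auto
  then have "max_error (poly_chain fstar T) {\<epsilon>..1} \<le> e"
    using assms(3,4) by (intro max_error_least) auto
  also have "e \<le> r"
  \<comment> \<open>If \<open>r \<ge> 1\<close> then \<open>e < 1\<close> suffices. Otherwise the
    competing chain stays away from 0 and the ratio invariant applies.\<close>
  proof (cases "r < 1")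
    case True
    have dev: "\<bar>poly_chain f T x - 1\<bar> \<le> r" if "x \<in> {\<epsilon>..1}" for x
      using that assms(3) unfolding r_def by (intro max_error_upper continuous_on_poly_chain)
    have "poly_chain f T x \<noteq> 0" if "x \<in> {\<epsilon>..1}" for x
      using dev[OF that] True by auto
    then obtain x y where xy: "x \<in> {\<epsilon>..1}" "y \<in> {\<epsilon>..1}"
      "\<bar>poly_chain f T x\<bar> * (1 + e) \<le> (1 - e) * \<bar>poly_chain f T y\<bar>"
      using poly_chain_ratio_le[OF assms(2-5) f _ order_refl] ab by auto
    \<comment> \<open>The chain of estimates yields
      \<open>(1 - r) * (1 + e) \<le> (1 - e) * (1 + r)\<close>, which simplifies to
      \<open>e \<le> r\<close>.\<close>
    have "(1 - r) * (1 + e) \<le> \<bar>poly_chain f T x\<bar> * (1 + e)"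
      using dev[OF xy(1)] e by (intro mult_right_mono) auto
    also note xy(3)
    also have "(1 - e) * \<bar>poly_chain f T y\<bar> \<le> (1 - e) * (1 + r)"
      using dev[OF xy(2)] e by (intro mult_left_mono) auto
    finally show ?thesis
      by (simp add: algebra_simps)
  qed (use e in auto)
  finally show "max_error (poly_chain fstar T) ({-1..-\<epsilon>} \<union> {\<epsilon>..1})
      \<le> max_error (poly_chain f T) ({-1..-\<epsilon>} \<union> {\<epsilon>..1})"
    unfolding sym[OF odd] sym[OF f] r_def .
qed

end
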